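(* The map $\sigma\colon\Lambda(\mathsf{MIPC})\to\Lambda(\mathsf{MGrz})$, $\sigma\mathsf L=\mathsf{MGrz}+\{\varphi^t:\mathsf L\vdash\varphi\}$, is not onto; hence it is not an isomorphism.
   Context: $\mathcal L_{\forall\exists}$ is the propositional language with connectives $\bot,\wedge,\vee,\to$ (and $\neg\varphi=\varphi\to\bot$) and two unary modalities $\forall,\exists$. $\mathsf{MIPC}$ is the smallest set of $\mathcal L_{\forall\exists}$-formulas containing all theorems of the intuitionistic propositional calculus and the formulas $\forall(p\land q)\leftrightarrow(\forall p\land\forall q)$, $\forall p\to p$, $\forall p\to\forall\forall p$, $\exists(p\vee q)\leftrightarrow(\exists p\vee\exists q)$, $p\to\exists p$, $\exists\exists p\to\exists p$, $(\exists p\land\exists q)\to\exists(\exists p\land q)$, $\exists\forall p\leftrightarrow\forall p$, $\exists p\leftrightarrow\forall\exists p$, and closed under modus ponens, substitution, and necessitation $\varphi/\forall\varphi$. An extension of $\mathsf{MIPC}$ is a set of $\mathcal L_{\forall\exists}$-formulas containing $\mathsf{MIPC}$ and closed under the same rules. $\Lambda(\mathsf{MIPC})$ is the complete lattice of extensions of $\mathsf{MIPC}$ ordered by inclusion. $\mathcal L_{\Box\forall}$ is the classical propositional modal language with two unary modalities $\Box,\forall$; $\exists$ abbreviates $\neg\forall\neg$. $\mathsf{MS4}$ is the smallest set of $\mathcal L_{\Box\forall}$-formulas containing all theorems of classical propositional calculus, the $\mathsf{S4}$-axioms for $\Box$, the $\mathsf{S5}$-axioms for $\forall$, the axiom $\Box\forall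 p\to\forall\Box p$, and closed under modus ponens, substitution, $\Box$-necessitation and $\forall$-necessitation. Extensions of $\mathsf{MS4}$ are sets of $\mathcal L_{\Box\forall}$-formulas containing $\mathsf{MS4}$ and closed under these rules; for an extension $\mathsf M$ and a set of formulas $\Gamma$, $\mathsf M+\Gamma$ is the least extension containing $\mathsf M\cup\Gamma$. $\mathsf{MGrz}=\mathsf{MS4}+\{\Box(\Box(p\to\Box p)\to p)\to p\}$, and $\Lambda(\mathsf{MGrz})$ is the complete lattice (under inclusion) of extensions of $\mathsf{MS4}$ containing $\mathsf{MGrz}$. $\mathsf L\vdash\varphi$ means $\varphi\in\mathsf L$. The Gödel translation $(-)^t$ from $\mathcal L_{\forall\exists}$-formulas to $\mathcal L_{\Box\forall}$-formulas: $\bot^t=\bot$, $p^t=\Box p$ for propositional letters $p$, $(\varphi\land\psi)^t=\varphi^t\land\psi^t$, $(\varphi\lor\psi)^t=\varphi^t\lor\psi^t$, $(\varphi\to\psi)^t=\Box(\neg\varphi^t\lor\psi^t)$, $(\forall\varphi)^t=\Box\forall\varphi^t$, $(\exists\varphi)^t=\exists\varphi^t$. *)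

theory Defs
  imports Main "HOL-Library.FuncSet"
begin

datatype ifm =
    IVar nat
  | IBot  ("\<bottom>\<^sub>i")
  | IAnd ifm ifm  (infixr "\<and>\<^sub>i" 75)
  | IOr ifm ifm  (infixr "\<or>\<^sub>i" 70)
  | IImp ifm ifm  (infixr "\<rightarrow>\<^sub>i" 65)
  | IAll ifm  ("\<forall>\<^sub>i _" [80] 80)
  | IEx ifm  ("\<exists>\<^sub>i _" [80] 80)

abbreviation IIff :: "ifm \<Rightarrow> ifm \<Rightarrow> ifm"  (infix "\<leftrightarrow>\<^sub>i" 60)
  where "\<phi> \<leftrightarrow>\<^sub>i \<psi> \<equiv> (\<phi> \<rightarrow>\<^sub>i \<psi>) \<and>\<^sub>i (\<psi> \<rightarrow>\<^sub>i \<phi>)"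

primrec isubst :: "(nat \<Rightarrow> ifm) \<Rightarrow> ifm \<Rightarrow> ifm" where
  "isubst s (IVar n) = s n"
| "isubst s \<bottom>\<^sub>i = \<bottom>\<^sub>i"
| "isubst s (\<phi> \<and>\<^sub>i \<psi>) = isubst s \<phi> \<and>\<^sub>i isubst s \<psi>"
| "isubst s (\<phi> \<or>\<^sub>i \<psi>) = isubst s \<phi> \<or>\<^sub>i isubst s \<psi>"
| "isubst s (\<phi> \<rightarrow>\<^sub>i \<psi>) = isubst s \<phi> \<rightarrow>\<^sub>i isubst s \<psi>"
| "isubst s (\<forall>\<^sub>i \<phi>) = \<forall>\<^sub>i (isubst s \<phi>)"
| "isubst s (\<exists>\<^sub>i \<phi>) = \<exists>\<^sub>i (isubst s \<phi>)"

text \<open>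
  A Hilbert calculus for intuitionistic propositional logic. The metavariables range over the whole
  modal language, so this is the set of substitution instances of the theorems in the modality-free
  fragment; the logics below are closed under substitution.
\<close>

inductive_set IPC :: "ifm set" where
  "\<phi> \<rightarrow>\<^sub>i \<psi> \<rightarrow>\<^sub>i \<phi> \<in> IPC"
| "(\<phi> \<rightarrow>\<^sub>i \<psi> \<rightarrow>\<^sub>i \<chi>) \<rightarrow>\<^sub>i (\<phi> \<rightarrow>\<^sub>i \<psi>) \<rightarrow>\<^sub>i \<phi> \<rightarrow>\<^sub>i \<chi> \<in> IPC"
| "\<phi> \<and>\<^sub>i \<psi> \<rightarrow>\<^sub>i \<phi> \<in> IPC"
| "\<phi> \<and>\<^sub>i \<psi> \<rightarrow>\<^sub>i \<psi> \<in> IPC"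
| "\<phi> \<rightarrow>\<^sub>i \<psi> \<rightarrow>\<^sub>i \<phi> \<and>\<^sub>i \<psi> \<in> IPC"
| "\<phi> \<rightarrow>\<^sub>i \<phi> \<or>\<^sub>i \<psi> \<in> IPC"
| "\<psi> \<rightarrow>\<^sub>i \<phi> \<or>\<^sub>i \<psi> \<in> IPC"
| "(\<phi> \<rightarrow>\<^sub>i \<chi>) \<rightarrow>\<^sub>i (\<psi> \<rightarrow>\<^sub>i \<chi>) \<rightarrow>\<^sub>i \<phi> \<or>\<^sub>i \<psi> \<rightarrow>\<^sub>i \<chi> \<in> IPC"
| "\<bottom>\<^sub>i \<rightarrow>\<^sub>i \<phi> \<in> IPC"
| "\<phi> \<in> IPC \<Longrightarrow> \<phi> \<rightarrow>\<^sub>i \<psi> \<in> IPC \<Longrightarrow> \<psi> \<in> IPC"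

definition MIPC_axioms :: "ifm set" where
  "MIPC_axioms = (let p = IVar 0; q = IVar 1 in
    { \<forall>\<^sub>i (p \<and>\<^sub>i q) \<leftrightarrow>\<^sub>i (\<forall>\<^sub>i p \<and>\<^sub>i \<forall>\<^sub>i q),
      \<forall>\<^sub>i p \<rightarrow>\<^sub>i p,
      \<forall>\<^sub>i p \<rightarrow>\<^sub>i \<forall>\<^sub>i \<forall>\<^sub>i p,
      \<exists>\<^sub>i (p \<or>\<^sub>i q) \<leftrightarrow>\<^sub>i (\<exists>\<^sub>i p \<or>\<^sub>i \<exists>\<^sub>i q),
      p \<rightarrow>\<^sub>i \<exists>\<^sub>i p,
      \<exists>\<^sub>i \<exists>\<^sub>i p \<rightarrow>\<^sub>i \<exists>\<^sub>i p,
      (\<exists>\<^sub>i p \<and>\<^sub>i \<exists>\<^sub>i q) \<rightarrow>\<^sub>i \<exists>\<^sub>i (\<exists>\<^sub>i p \<and>\<^sub>i q),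
      \<exists>\<^sub>i \<forall>\<^sub>i p \<leftrightarrow>\<^sub>i \<forall>\<^sub>i p,
      \<exists>\<^sub>i p \<leftrightarrow>\<^sub>i \<forall>\<^sub>i \<exists>\<^sub>i p })"

definition iclosed :: "ifm set \<Rightarrow> bool" where
  "iclosed L \<longleftrightarrow>
    (\<forall>\<phi> \<psi>. \<phi> \<in> L \<longrightarrow> \<phi> \<rightarrow>\<^sub>i \<psi> \<in> L \<longrightarrow> \<psi> \<in> L) \<and>
    (\<forall>\<phi> s. \<phi> \<in> L \<longrightarrow> isubst s \<phi> \<in> L) \<and>
    (\<forall>\<phi>. \<phi> \<in> L \<longrightarrow> \<forall>\<^sub>i \<phi> \<in> L)"

definition MIPC :: "ifm set" where
  "MIPC = \<Inter> {L. IPC \<subseteq> L \<and> MIPC_axioms \<subseteq> L \<and> iclosed L}"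

definition Lambda_MIPC :: "ifm set set" where
  "Lambda_MIPC = {L. MIPC \<subseteq> L \<and> iclosed L}"

datatype cfm =
    CVar nat
  | CBot  ("\<bottom>\<^sub>c")
  | CAnd cfm cfm  (infixr "\<and>\<^sub>c" 75)
  | COr cfm cfm  (infixr "\<or>\<^sub>c" 70)
  | CImp cfm cfm  (infixr "\<rightarrow>\<^sub>c" 65)
  | CBox cfm  ("\<box>\<^sub>c _" [80] 80)
  | CAll cfm  ("\<forall>\<^sub>c _" [80] 80)

abbreviation CNot :: "cfm \<Rightarrow> cfm"  ("\<not>\<^sub>c _" [80] 80)
  where "\<not>\<^sub>c \<phi> \<equiv> \<phi> \<rightarrow>\<^sub>c \<bottom>\<^sub>c"

abbreviation CEx :: "cfm \<Rightarrow> cfm"  ("\<exists>\<^sub>c _" [80] 80)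
  where "\<exists>\<^sub>c \<phi> \<equiv> \<not>\<^sub>c \<forall>\<^sub>c \<not>\<^sub>c \<phi>"

primrec csubst :: "(nat \<Rightarrow> cfm) \<Rightarrow> cfm \<Rightarrow> cfm" where
  "csubst s (CVar n) = s n"
| "csubst s \<bottom>\<^sub>c = \<bottom>\<^sub>c"
| "csubst s (\<phi> \<and>\<^sub>c \<psi>) = csubst s \<phi> \<and>\<^sub>c csubst s \<psi>"
| "csubst s (\<phi> \<or>\<^sub>c \<psi>) = csubst s \<phi> \<or>\<^sub>c csubst s \<psi>"
| "csubst s (\<phi> \<rightarrow>\<^sub>c \<psi>) = csubst s \<phi> \<rightarrow>\<^sub>c csubst s \<psi>"
| "csubst s (\<box>\<^sub>c \<phi>) = \<box>\<^sub>c (csubst s \<phi>)"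
| "csubst s (\<forall>\<^sub>c \<phi>) = \<forall>\<^sub>c (csubst s \<phi>)"

text \<open>As for \<open>IPC\<close>, the schemes range over the whole bimodal language.\<close>

inductive_set CPC :: "cfm set" where
  "\<phi> \<rightarrow>\<^sub>c \<psi> \<rightarrow>\<^sub>c \<phi> \<in> CPC"
| "(\<phi> \<rightarrow>\<^sub>c \<psi> \<rightarrow>\<^sub>c \<chi>) \<rightarrow>\<^sub>c (\<phi> \<rightarrow>\<^sub>c \<psi>) \<rightarrow>\<^sub>c \<phi> \<rightarrow>\<^sub>c \<chi> \<in> CPC"
| "\<phi> \<and>\<^sub>c \<psi> \<rightarrow>\<^sub>c \<phi> \<in> CPC"
| "\<phi> \<and>\<^sub>c \<psi> \<rightarrow>\<^sub>c \<psi> \<in> CPC"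
| "\<phi> \<rightarrow>\<^sub>c \<psi> \<rightarrow>\<^sub>c \<phi> \<and>\<^sub>c \<psi> \<in> CPC"
| "\<phi> \<rightarrow>\<^sub>c \<phi> \<or>\<^sub>c \<psi> \<in> CPC"
| "\<psi> \<rightarrow>\<^sub>c \<phi> \<or>\<^sub>c \<psi> \<in> CPC"
| "(\<phi> \<rightarrow>\<^sub>c \<chi>) \<rightarrow>\<^sub>c (\<psi> \<rightarrow>\<^sub>c \<chi>) \<rightarrow>\<^sub>c \<phi> \<or>\<^sub>c \<psi> \<rightarrow>\<^sub>c \<chi> \<in> CPC"
| "\<bottom>\<^sub>c \<rightarrow>\<^sub>c \<phi> \<in> CPC"
| "\<phi> \<or>\<^sub>c \<not>\<^sub>c \<phi> \<in> CPC"
| "\<phi> \<in> CPC \<Longrightarrow> \<phi> \<rightarrow>\<^sub>c \<psi> \<in> CPC \<Longrightarrow> \<psi> \<in> CPC"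

definition MS4_axioms :: "cfm set" where
  "MS4_axioms = (let p = CVar 0; q = CVar 1 in
    { \<box>\<^sub>c (p \<rightarrow>\<^sub>c q) \<rightarrow>\<^sub>c \<box>\<^sub>c p \<rightarrow>\<^sub>c \<box>\<^sub>c q,
      \<box>\<^sub>c p \<rightarrow>\<^sub>c p,
      \<box>\<^sub>c p \<rightarrow>\<^sub>c \<box>\<^sub>c \<box>\<^sub>c p,
      \<forall>\<^sub>c (p \<rightarrow>\<^sub>c q) \<rightarrow>\<^sub>c \<forall>\<^sub>c p \<rightarrow>\<^sub>c \<forall>\<^sub>c q,
      \<forall>\<^sub>c p \<rightarrow>\<^sub>c p,
      \<forall>\<^sub>c p \<rightarrow>\<^sub>c \<forall>\<^sub>c \<forall>\<^sub>c p,
      \<exists>\<^sub>c p \<rightarrow>\<^sub>c \<forall>\<^sub>c \<exists>\<^sub>c p,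
      \<box>\<^sub>c \<forall>\<^sub>c p \<rightarrow>\<^sub>c \<forall>\<^sub>c \<box>\<^sub>c p })"

definition cclosed :: "cfm set \<Rightarrow> bool" where
  "cclosed M \<longleftrightarrow>
    (\<forall>\<phi> \<psi>. \<phi> \<in> M \<longrightarrow> \<phi> \<rightarrow>\<^sub>c \<psi> \<in> M \<longrightarrow> \<psi> \<in> M) \<and>
    (\<forall>\<phi> s. \<phi> \<in> M \<longrightarrow> csubst s \<phi> \<in> M) \<and>
    (\<forall>\<phi>. \<phi> \<in> M \<longrightarrow> \<box>\<^sub>c \<phi> \<in> M) \<and>
    (\<forall>\<phi>. \<phi> \<in> M \<longrightarrow> \<forall>\<^sub>c \<phi> \<in> M)"

definition MS4 :: "cfm set" where
  "MS4 = \<Inter> {M. CPC \<subseteq> M \<and> MS4_axioms \<subseteq> M \<and> cclosed M}"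

definition Lambda_MS4 :: "cfm set set" where
  "Lambda_MS4 = {M. MS4 \<subseteq> M \<and> cclosed M}"

definition ext_plus :: "cfm set \<Rightarrow> cfm set \<Rightarrow> cfm set"  (infixl "\<oplus>" 65) where
  "M \<oplus> \<Gamma> = \<Inter> {N \<in> Lambda_MS4. M \<union> \<Gamma> \<subseteq> N}"

definition MGrz :: "cfm set" where
  "MGrz = (let p = CVar 0 in MS4 \<oplus> {\<box>\<^sub>c (\<box>\<^sub>c (p \<rightarrow>\<^sub>c \<box>\<^sub>c p) \<rightarrow>\<^sub>c p) \<rightarrow>\<^sub>c p})"

definition Lambda_MGrz :: "cfm set set" where
  "Lambda_MGrz = {M \<in> Lambda_MS4. MGrz \<subseteq> M}"

primrec goedel :: "ifm \<Rightarrow> cfm" where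
  "goedel (IVar n) = \<box>\<^sub>c (CVar n)"
| "goedel \<bottom>\<^sub>i = \<bottom>\<^sub>c"
| "goedel (\<phi> \<and>\<^sub>i \<psi>) = goedel \<phi> \<and>\<^sub>c goedel \<psi>"
| "goedel (\<phi> \<or>\<^sub>i \<psi>) = goedel \<phi> \<or>\<^sub>c goedel \<psi>"
| "goedel (\<phi> \<rightarrow>\<^sub>i \<psi>) = \<box>\<^sub>c (\<not>\<^sub>c (goedel \<phi>) \<or>\<^sub>c goedel \<psi>)"
| "goedel (\<forall>\<^sub>i \<phi>) = \<box>\<^sub>c \<forall>\<^sub>c (goedel \<phi>)"
| "goedel (\<exists>\<^sub>i \<phi>) = \<exists>\<^sub>c (goedel \<phi>)"

definition sigma :: "ifm set \<Rightarrow> cfm set" where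
  "sigma L = MGrz \<oplus> goedel ` L"

text \<open>
  For complete lattices ordered by inclusion, the lattice isomorphisms are exactly the order
  isomorphisms.
\<close>

definition inclusion_iso :: "('a set \<Rightarrow> 'b set) \<Rightarrow> 'a set set \<Rightarrow> 'b set set \<Rightarrow> bool" where
  "inclusion_iso f A B \<longleftrightarrow>
    bij_betw f A B \<and> (\<forall>X\<in>A. \<forall>Y\<in>A. X \<subseteq> Y \<longleftrightarrow> f X \<subseteq> f Y)"

end

theory Submission
  imports Defs
begin

text \<open>
  Kripke frames for \<open>MS4\<close> carry a quasi-order \<open>R\<close> and an equivalence \<open>E\<close>; a Goedel translation only
  ever talks about \<open>R\<close>-upsets. On upsets, \<open>\<exists>\<close> cannot tell whether an \<open>E\<close>-class contains a point
  or only something \<open>R\<close>-above it, and \<open>\<forall>\<close> is only used in the form \<open>\<box>\<forall>\<close>, which looks along the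
  composite of \<open>R\<close> and \<open>E\<close>. So the maps between frames that preserve Goedel translations
  (\<open>upset_morphism\<close>) form a wider class than the p-morphisms, which preserve all formulas, and
  this is what breaks surjectivity.

  Let \<open>A\<close> and \<open>B\<close> be \<open>MGrz\<close>-frames with such a map from \<open>A\<close> onto \<open>B\<close>, and suppose that the logic
  of \<open>A\<close> is \<open>\<sigma> L\<close>. The translations of the theorems of \<open>L\<close> are valid in \<open>A\<close>, hence in \<open>B\<close>, so the
  whole of \<open>\<sigma> L\<close>, which they generate over \<open>MGrz\<close>, is valid in \<open>B\<close>. Therefore every
  formula valid in \<open>A\<close> is valid in \<open>B\<close> (\<open>frame_logic_sigma_transfer\<close>).

  It remains to find \<open>A\<close> and \<open>B\<close> for which this fails. Take for \<open>A\<close> the frame whose root is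
  below \<open>AMid\<close> and \<open>ASide\<close>, while \<open>AMid\<close> and \<open>ALow\<close> are below \<open>ATop\<close>; the only nontrivial class is
  \<open>{ALow, ATop}\<close>. The frame \<open>B\<close> arises by identifying \<open>AMid\<close> with \<open>ATop\<close>. The singleton class
  of \<open>AMid\<close> then lands in the class \<open>{BLow, BTop}\<close> without covering \<open>BLow\<close>; that is invisible to
  upsets, because every upset containing \<open>BLow\<close> contains \<open>BTop\<close>. But a bimodal formula can name
  \<open>BLow\<close>, and with its help say that nothing lies between the root and the class of
  \<open>BLow\<close>; this is satisfiable in \<open>B\<close> and not in \<open>A\<close>, where \<open>AMid\<close> lies in between.
\<close>

section \<open>Kripke semantics of the bimodal language\<close>

primrec csat ::
  "('w \<Rightarrow> 'w \<Rightarrow> bool) \<Rightarrow> ('w \<Rightarrow> 'w \<Rightarrow> bool) \<Rightarrow> (nat \<Rightarrow> 'w \<Rightarrow> bool) \<Rightarrow> 'w \<Rightarrow> cfm \<Rightarrow> bool" where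
  "csat R E V w (CVar n) \<longleftrightarrow> V n w"
| "csat R E V w \<bottom>\<^sub>c \<longleftrightarrow> False"
| "csat R E V w (\<phi> \<and>\<^sub>c \<psi>) \<longleftrightarrow> csat R E V w \<phi> \<and> csat R E V w \<psi>"
| "csat R E V w (\<phi> \<or>\<^sub>c \<psi>) \<longleftrightarrow> csat R E V w \<phi> \<or> csat R E V w \<psi>"
| "csat R E V w (\<phi> \<rightarrow>\<^sub>c \<psi>) \<longleftrightarrow> (csat R E V w \<phi> \<longrightarrow> csat R E V w \<psi>)"
| "csat R E V w (\<box>\<^sub>c \<phi>) \<longleftrightarrow> (\<forall>v. R w v \<longrightarrow> csat R E V v \<phi>)"
| "csat R E V w (\<forall>\<^sub>c \<phi>) \<longleftrightarrow> (\<forall>v. E w v \<longrightarrow> csat R E V v \<phi>)"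

definition frame_logic :: "('w \<Rightarrow> 'w \<Rightarrow> bool) \<Rightarrow> ('w \<Rightarrow> 'w \<Rightarrow> bool) \<Rightarrow> cfm set" where
  "frame_logic R E = {\<phi>. \<forall>V w. csat R E V w \<phi>}"

lemma csat_csubst:
  "csat R E V w (csubst s \<phi>) \<longleftrightarrow> csat R E (\<lambda>n v. csat R E V v (s n)) w \<phi>"
  by (induction \<phi> arbitrary: w) auto

lemma CPC_sound: "\<phi> \<in> CPC \<Longrightarrow> csat R E V w \<phi>"
  by (induction rule: CPC.induct) auto

lemma cclosed_frame_logic: "cclosed (frame_logic R E)"
  unfolding cclosed_def frame_logic_def by (auto simp: csat_csubst)

locale ms4_frame =
  fixes R E :: "'w \<Rightarrow> 'w \<Rightarrow> bool"
  assumes R_refl: "R x x"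
    and R_trans: "R x y \<Longrightarrow> R y z \<Longrightarrow> R x z"
    and E_refl: "E x x"
    and E_sym: "E x y \<Longrightarrow> E y x"
    and E_trans: "E x y \<Longrightarrow> E y z \<Longrightarrow> E x z"
    and E_R_commute: "E x y \<Longrightarrow> R y z \<Longrightarrow> \<exists>u. R x u \<and> E u z"
begin

lemma MS4_axioms_sound: "MS4_axioms \<subseteq> frame_logic R E"
proof -
  have "csat R E V w \<phi>" if "\<phi> \<in> MS4_axioms" for \<phi> V w
    using that unfolding MS4_axioms_def Let_def
    by (elim insertE emptyE; simp; meson R_refl R_trans E_refl E_sym E_trans E_R_commute)
  then show ?thesis
    unfolding frame_logic_def by blast
qed

lemma frame_logic_in_Lambda_MS4: "frame_logic R E \<in> Lambda_MS4"
proof -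
  have "CPC \<subseteq> frame_logic R E"
    unfolding frame_logic_def by (auto intro: CPC_sound)
  with MS4_axioms_sound cclosed_frame_logic show ?thesis
    unfolding Lambda_MS4_def MS4_def by blast
qed

text \<open>
  The case of \<open>\<exists>\<close> is where the commutation of \<open>R\<close> and \<open>E\<close> enters: a witness in the class of \<open>w\<close> is
  pushed up to a witness in the class of \<open>v\<close>.
\<close>

lemma goedel_persistent:
  "csat R E V w (goedel \<phi>) \<Longrightarrow> R w v \<Longrightarrow> csat R E V v (goedel \<phi>)"
proof (induction \<phi> arbitrary: w v)
  case (IEx \<phi>)
  then obtain u where u: "E w u" "csat R E V u (goedel \<phi>)"
    by auto
  obtain z where "R u z" "E z v"
    using E_R_commute E_sym u(1) IEx.prems(2) by blast
  with u IEx.IH have "E v z" "csat R E V z (goedel \<phi>)"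
    using E_sym by blast+
  then show ?case
    by auto
qed (auto intro: R_trans)

end

locale mgrz_frame = ms4_frame +
  assumes no_ascending_chain: "wfp (\<lambda>y x. R x y \<and> x \<noteq> y)"
begin

lemma no_cycle: "R x y \<Longrightarrow> R y x \<Longrightarrow> x = y"
  using wfp_imp_asymp[OF no_ascending_chain] by (auto dest: asympD)

lemma Grz_sound:
  "csat R E V w (\<box>\<^sub>c (\<box>\<^sub>c (\<phi> \<rightarrow>\<^sub>c \<box>\<^sub>c \<phi>) \<rightarrow>\<^sub>c \<phi>) \<rightarrow>\<^sub>c \<phi>)"
proof -
  have "csat R E V w \<phi>"
    if step: "\<forall>v. R w v \<longrightarrow> (\<forall>u. R v u \<longrightarrow> csat R E V u \<phi> \<longrightarrow> (\<forall>z. R u z \<longrightarrow> csat R E V z \<phi>))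
      \<longrightarrow> csat R E V v \<phi>"
  proof -
    have "R w v \<longrightarrow> csat R E V v \<phi>" for v
    proof (induction v rule: wfp_induct_rule[OF no_ascending_chain])
      case (1 v)
      show ?case
      proof
        assume wv: "R w v"
        have above: "csat R E V z \<phi>" if "R v z" "z \<noteq> v" for z
          using 1[of z] that R_trans[OF wv, of z] by simp
        have "csat R E V z \<phi>" if "R v u" "csat R E V u \<phi>" "R u z" for u z
        proof (cases "z = v")
          case True
          \<comment> \<open>If \<open>u\<close> were different from \<open>v\<close>, it would lie on a cycle through \<open>v\<close>.\<close>
          have "u = v"
            using that(1,3) no_cycle True by blast
          then show ?thesis
            using True that(2) by simp
        next
          case False
          then show ?thesis
            using above R_trans[OF that(1,3)] by blast
        qed
        then show "csat R E V v \<phi>"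
          using step wv by blast
      qed
    qed
    then show ?thesis
      using R_refl[of w] by blast
  qed
  then show ?thesis
    by (simp only: csat.simps) blast
qed

lemma frame_logic_in_Lambda_MGrz: "frame_logic R E \<in> Lambda_MGrz"
proof -
  have "\<box>\<^sub>c (\<box>\<^sub>c (CVar 0 \<rightarrow>\<^sub>c \<box>\<^sub>c CVar 0) \<rightarrow>\<^sub>c CVar 0) \<rightarrow>\<^sub>c CVar 0 \<in> frame_logic R E"
    unfolding frame_logic_def mem_Collect_eq by (intro allI Grz_sound)
  with frame_logic_in_Lambda_MS4 show ?thesis
    unfolding Lambda_MGrz_def MGrz_def ext_plus_def Let_def
    by (auto simp: Lambda_MS4_def)
qed

end

section \<open>Maps that preserve Goedel translations\<close>

text \<open>
  Both back conditions for \<open>E\<close> are weaker than that of a p-morphism, which asks for a point of the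
  class of \<open>x\<close> itself that is mapped to \<open>y'\<close>. Truth of \<open>\<exists>\<phi>\<close> is governed by \<open>back_E_up\<close>, truth of
  \<open>\<box>\<forall>\<phi>\<close> by \<open>back_RE\<close>.
\<close>

locale upset_morphism = A: ms4_frame R E + B: ms4_frame R' E'
  for R E :: "'a \<Rightarrow> 'a \<Rightarrow> bool" and R' E' :: "'b \<Rightarrow> 'b \<Rightarrow> bool" +
  fixes f :: "'a \<Rightarrow> 'b"
  assumes surj: "surj f"
    and forth_R: "R x y \<Longrightarrow> R' (f x) (f y)"
    and back_R: "R' (f x) y' \<Longrightarrow> \<exists>y. R x y \<and> f y = y'"
    and forth_E: "E x y \<Longrightarrow> E' (f x) (f y)"
    and back_E_up: "E' (f x) y' \<Longrightarrow> \<exists>z. E x z \<and> R' y' (f z)"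
    and back_RE: "R' (f x) u' \<Longrightarrow> E' u' y' \<Longrightarrow> \<exists>u y. R x u \<and> E u y \<and> f y = y'"
begin

text \<open>
  In the case of \<open>\<exists>\<close>, \<open>back_E_up\<close> only provides a point whose image lies above the witness in the
  target; persistence makes that image a witness as well.
\<close>

lemma csat_goedel_pullback:
  "csat R E (\<lambda>n w. V n (f w)) x (goedel \<phi>) \<longleftrightarrow> csat R' E' V (f x) (goedel \<phi>)"
proof (induction \<phi> arbitrary: x)
  case (IVar n)
  show ?case
    using forth_R back_R by simp metis
next
  case (IImp \<phi> \<psi>)
  show ?case
    using forth_R back_R by (simp add: IImp.IH) metis
next
  case (IAll \<phi>)
  show ?case
    using forth_R forth_E back_RE by (simp add: IAll.IH) metis
next
  case (IEx \<phi>)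
  show ?case
  proof
    assume "csat R E (\<lambda>n w. V n (f w)) x (goedel (\<exists>\<^sub>i \<phi>))"
    then show "csat R' E' V (f x) (goedel (\<exists>\<^sub>i \<phi>))"
      using forth_E by (auto simp: IEx.IH)
  next
    assume "csat R' E' V (f x) (goedel (\<exists>\<^sub>i \<phi>))"
    then obtain y' where "E' (f x) y'" "csat R' E' V y' (goedel \<phi>)"
      by auto
    then obtain z where "E x z" "csat R' E' V (f z) (goedel \<phi>)"
      using back_E_up B.goedel_persistent by blast
    then show "csat R E (\<lambda>n w. V n (f w)) x (goedel (\<exists>\<^sub>i \<phi>))"
      by (auto simp: IEx.IH)
  qed
qed simp_all

lemma goedel_valid_transfer:
  assumes "goedel \<phi> \<in> frame_logic R E"
  shows "goedel \<phi> \<in> frame_logic R' E'"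
proof -
  have "csat R' E' V y (goedel \<phi>)" for V y
  proof -
    obtain x where "y = f x"
      using surj by (meson surjD)
    then show ?thesis
      using assms csat_goedel_pullback[of V x \<phi>] unfolding frame_logic_def by blast
  qed
  then show ?thesis
    unfolding frame_logic_def by blast
qed

lemma frame_logic_sigma_transfer:
  assumes B: "mgrz_frame R' E'" and eq: "sigma L = frame_logic R E"
  shows "frame_logic R E \<subseteq> frame_logic R' E'"
proof -
  have "goedel ` L \<subseteq> frame_logic R E"
    unfolding eq[symmetric] sigma_def ext_plus_def by blast
  then have "goedel ` L \<subseteq> frame_logic R' E'"
    using goedel_valid_transfer by blast
  moreover have "MGrz \<subseteq> frame_logic R' E'"
    using mgrz_frame.frame_logic_in_Lambda_MGrz[OF B] unfolding Lambda_MGrz_def by blast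
  ultimately have "sigma L \<subseteq> frame_logic R' E'"
    using B.frame_logic_in_Lambda_MS4 unfolding sigma_def ext_plus_def by blast
  then show ?thesis
    unfolding eq .
qed

end

section \<open>The two frames\<close>

datatype point_A = ARoot | AMid | ASide | ALow | ATop

datatype point_B = BRoot | BSide | BLow | BTop

definition R_A :: "point_A \<Rightarrow> point_A \<Rightarrow> bool" where
  "R_A x y \<longleftrightarrow> x = y \<or> (x, y) \<in> {(ARoot, AMid), (ARoot, ASide), (ARoot, ATop), (AMid, ATop), (ALow, ATop)}"

definition E_A :: "point_A \<Rightarrow> point_A \<Rightarrow> bool" where
  "E_A x y \<longleftrightarrow> x = y \<or> {x, y} = {ALow, ATop}"

definition R_B :: "point_B \<Rightarrow> point_B \<Rightarrow> bool" where
  "R_B x y \<longleftrightarrow> x = y \<or> (x, y) \<in> {(BRoot, BSide), (BRoot, BTop), (BLow, BTop)}"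

definition E_B :: "point_B \<Rightarrow> point_B \<Rightarrow> bool" where
  "E_B x y \<longleftrightarrow> x = y \<or> {x, y} = {BLow, BTop}"

fun collapse :: "point_A \<Rightarrow> point_B" where
  "collapse ARoot = BRoot"
| "collapse AMid = BTop"
| "collapse ASide = BSide"
| "collapse ALow = BLow"
| "collapse ATop = BTop"

lemma all_point_A: "(\<forall>x. P x) \<longleftrightarrow> P ARoot \<and> P AMid \<and> P ASide \<and> P ALow \<and> P ATop"
  using point_A.induct[of P] by auto

lemma all_point_B: "(\<forall>x. P x) \<longleftrightarrow> P BRoot \<and> P BSide \<and> P BLow \<and> P BTop"
  using point_B.induct[of P] by auto

lemma ex_point_A: "(\<exists>x. P x) \<longleftrightarrow> P ARoot \<or> P AMid \<or> P ASide \<or> P ALow \<or> P ATop"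
  using all_point_A[of "\<lambda>x. \<not> P x"] by auto

lemma ex_point_B: "(\<exists>x. P x) \<longleftrightarrow> P BRoot \<or> P BSide \<or> P BLow \<or> P BTop"
  using all_point_B[of "\<lambda>x. \<not> P x"] by auto

lemma mgrz_frame_A: "mgrz_frame R_A E_A"
proof
  fix x y z
  show "R_A x x" "E_A x x"
    by (simp_all add: R_A_def E_A_def)
  show "R_A x y \<Longrightarrow> R_A y z \<Longrightarrow> R_A x z"
    by (auto simp: R_A_def)
  show "E_A x y \<Longrightarrow> E_A y x" "E_A x y \<Longrightarrow> E_A y z \<Longrightarrow> E_A x z"
    by (auto simp: E_A_def doubleton_eq_iff)
  show "E_A x y \<Longrightarrow> R_A y z \<Longrightarrow> \<exists>u. R_A x u \<and> E_A u z"
    by (cases x; cases y; cases z; simp add: R_A_def E_A_def ex_point_A doubleton_eq_iff)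
next
  define depth where
    "depth x = (case x of ARoot \<Rightarrow> 2 | AMid \<Rightarrow> 1 | ASide \<Rightarrow> 0 | ALow \<Rightarrow> 1 | ATop \<Rightarrow> (0::nat))" for x
  show "wfp (\<lambda>y x. R_A x y \<and> x \<noteq> y)"
    by (rule wfp_if_convertible_to_nat[where f = depth]) (auto simp: R_A_def depth_def)
qed

lemma mgrz_frame_B: "mgrz_frame R_B E_B"
proof
  fix x y z
  show "R_B x x" "E_B x x"
    by (simp_all add: R_B_def E_B_def)
  show "R_B x y \<Longrightarrow> R_B y z \<Longrightarrow> R_B x z"
    by (auto simp: R_B_def)
  show "E_B x y \<Longrightarrow> E_B y x" "E_B x y \<Longrightarrow> E_B y z \<Longrightarrow> E_B x z"
    by (auto simp: E_B_def doubleton_eq_iff)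
  show "E_B x y \<Longrightarrow> R_B y z \<Longrightarrow> \<exists>u. R_B x u \<and> E_B u z"
    by (cases x; cases y; cases z; simp add: R_B_def E_B_def ex_point_B doubleton_eq_iff)
next
  define depth where
    "depth x = (case x of BRoot \<Rightarrow> 1 | BSide \<Rightarrow> 0 | BLow \<Rightarrow> 1 | BTop \<Rightarrow> (0::nat))" for x
  show "wfp (\<lambda>y x. R_B x y \<and> x \<noteq> y)"
    by (rule wfp_if_convertible_to_nat[where f = depth]) (auto simp: R_B_def depth_def)
qed

lemma upset_morphism_collapse: "upset_morphism R_A E_A R_B E_B collapse"
proof -
  interpret A: mgrz_frame R_A E_A
    by (rule mgrz_frame_A)
  interpret B: mgrz_frame R_B E_B
    by (rule mgrz_frame_B)
  show ?thesis
  proof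
    show "surj collapse"
      by (simp add: surj_def all_point_B ex_point_A)
  next
    fix x y
    show "R_A x y \<Longrightarrow> R_B (collapse x) (collapse y)"
      by (cases x; cases y; simp add: R_A_def R_B_def)
    show "E_A x y \<Longrightarrow> E_B (collapse x) (collapse y)"
      by (cases x; cases y; simp add: E_A_def E_B_def doubleton_eq_iff)
  next
    fix x y'
    show "R_B (collapse x) y' \<Longrightarrow> \<exists>y. R_A x y \<and> collapse y = y'"
      by (cases x; cases y'; simp add: R_A_def R_B_def ex_point_A)
    show "E_B (collapse x) y' \<Longrightarrow> \<exists>z. E_A x z \<and> R_B y' (collapse z)"
      by (cases x; cases y'; simp add: E_A_def E_B_def R_B_def ex_point_A doubleton_eq_iff)
  next
    fix x u' y'
    show "R_B (collapse x) u' \<Longrightarrow> E_B u' y' \<Longrightarrow> \<exists>u y. R_A x u \<and> E_A u y \<and> collapse y = y'"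
      by (cases x; cases u'; cases y';
          simp add: R_A_def E_A_def R_B_def E_B_def ex_point_A doubleton_eq_iff)
  qed
qed

section \<open>A formula separating the two frames\<close>

abbreviation CDia :: "cfm \<Rightarrow> cfm" ("\<diamond>\<^sub>c _" [80] 80)
  where "\<diamond>\<^sub>c \<phi> \<equiv> \<not>\<^sub>c \<box>\<^sub>c \<not>\<^sub>c \<phi>"

text \<open>
  The intended valuation makes \<open>p\<close> true at \<open>BLow\<close> only, and the formula describes \<open>BRoot\<close>. The
  first two conjuncts together force \<open>p\<close> to be false at all successors of the present point: a
  class that meets \<open>p\<close> can be entered, but not at a point satisfying \<open>p\<close>. The next two say that one
  can move into a class meeting \<open>p\<close>, and also to a point from which no such class is accessible any
  more. The last conjunct excludes an intermediate step: as long as a class meeting \<open>p\<close> lies ahead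
  and is not yet entered, the second option remains open.
\<close>

definition direct_entry :: cfm where
  "direct_entry = (let p = CVar 0 in
     \<not>\<^sub>c \<exists>\<^sub>c p \<and>\<^sub>c \<box>\<^sub>c \<forall>\<^sub>c (\<diamond>\<^sub>c p \<rightarrow>\<^sub>c p) \<and>\<^sub>c \<diamond>\<^sub>c \<exists>\<^sub>c p \<and>\<^sub>c \<diamond>\<^sub>c \<box>\<^sub>c \<not>\<^sub>c \<exists>\<^sub>c p \<and>\<^sub>c
     \<box>\<^sub>c (\<diamond>\<^sub>c \<exists>\<^sub>c p \<rightarrow>\<^sub>c \<exists>\<^sub>c p \<or>\<^sub>c \<diamond>\<^sub>c \<box>\<^sub>c \<not>\<^sub>c \<exists>\<^sub>c p))"

lemma box_A:
  "(\<forall>y. R_A ARoot y \<longrightarrow> P y) \<longleftrightarrow> P ARoot \<and> P AMid \<and> P ASide \<and> P ATop"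
  "(\<forall>y. R_A AMid y \<longrightarrow> P y) \<longleftrightarrow> P AMid \<and> P ATop"
  "(\<forall>y. R_A ASide y \<longrightarrow> P y) \<longleftrightarrow> P ASide"
  "(\<forall>y. R_A ALow y \<longrightarrow> P y) \<longleftrightarrow> P ALow \<and> P ATop"
  "(\<forall>y. R_A ATop y \<longrightarrow> P y) \<longleftrightarrow> P ATop"
  by (simp_all add: R_A_def all_point_A)

lemma all_A:
  "(\<forall>y. E_A ARoot y \<longrightarrow> P y) \<longleftrightarrow> P ARoot"
  "(\<forall>y. E_A AMid y \<longrightarrow> P y) \<longleftrightarrow> P AMid"
  "(\<forall>y. E_A ASide y \<longrightarrow> P y) \<longleftrightarrow> P ASide"
  "(\<forall>y. E_A ALow y \<longrightarrow> P y) \<longleftrightarrow> P ALow \<and> P ATop"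
  "(\<forall>y. E_A ATop y \<longrightarrow> P y) \<longleftrightarrow> P ALow \<and> P ATop"
  by (simp_all add: E_A_def all_point_A doubleton_eq_iff)

text \<open>
  The first, third and fourth conjuncts leave only the root, since no other point of \<open>A\<close> has two
  maximal points above it. As \<open>p\<close> fails at the successors of the root, it can only be true at
  \<open>ALow\<close>, and it is true there by the third conjunct. But then \<open>AMid\<close> sees the class of \<open>ALow\<close>
  without being in it and cannot avoid it, against the last conjunct.
\<close>

lemma direct_entry_refuted_in_A: "\<not>\<^sub>c direct_entry \<in> frame_logic R_A E_A"
proof -
  have "\<not> csat R_A E_A V x direct_entry" for V x
    by (cases x; simp only: direct_entry_def Let_def csat.simps box_A all_A; blast)
  then show ?thesis
    unfolding frame_logic_def by simp
qed

lemma direct_entry_satisfiable_in_B: "\<not>\<^sub>c direct_entry \<notin> frame_logic R_B E_B"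
proof -
  have "csat R_B E_B (\<lambda>n x. x = BLow) BRoot direct_entry"
    by (simp add: direct_entry_def Let_def all_point_B ex_point_B R_B_def E_B_def doubleton_eq_iff)
  then show ?thesis
    unfolding frame_logic_def by auto
qed

section \<open>Failure of surjectivity\<close>

lemma cclosed_Inter:
  assumes "\<And>N. N \<in> \<N> \<Longrightarrow> cclosed N"
  shows "cclosed (\<Inter>\<N>)"
  unfolding cclosed_def
proof (intro conjI allI impI InterI)
  fix N \<phi> \<psi>
  assume "N \<in> \<N>" "\<phi> \<in> \<Inter>\<N>" "\<phi> \<rightarrow>\<^sub>c \<psi> \<in> \<Inter>\<N>"
  then show "\<psi> \<in> N"
    using assms[of N] unfolding cclosed_def by (metis InterD)
qed (use assms in \<open>simp_all add: cclosed_def\<close>)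

lemma ext_plus_in_Lambda_MS4: "M \<oplus> \<Gamma> \<in> Lambda_MS4"
proof -
  have "cclosed (M \<oplus> \<Gamma>)"
    unfolding ext_plus_def by (rule cclosed_Inter) (simp add: Lambda_MS4_def)
  moreover have "MS4 \<subseteq> M \<oplus> \<Gamma>"
    unfolding ext_plus_def by (rule Inter_greatest) (simp add: Lambda_MS4_def)
  ultimately show ?thesis
    by (simp add: Lambda_MS4_def)
qed

lemma sigma_in_Lambda_MGrz: "sigma L \<in> Lambda_MGrz"
proof -
  have "MGrz \<subseteq> sigma L"
    unfolding sigma_def ext_plus_def by (rule Inter_greatest) simp
  then show ?thesis
    by (simp add: Lambda_MGrz_def sigma_def ext_plus_in_Lambda_MS4)
qed

lemma frame_logic_A_not_sigma: "sigma L \<noteq> frame_logic R_A E_A"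
  using upset_morphism.frame_logic_sigma_transfer[OF upset_morphism_collapse mgrz_frame_B, of L]
    direct_entry_refuted_in_A direct_entry_satisfiable_in_B by auto

theorem theorem6p20:
  "sigma \<in> Lambda_MIPC \<rightarrow> Lambda_MGrz \<and>
   sigma ` Lambda_MIPC \<noteq> Lambda_MGrz \<and>
   \<not> inclusion_iso sigma Lambda_MIPC Lambda_MGrz"
proof -
  have "frame_logic R_A E_A \<in> Lambda_MGrz"
    by (rule mgrz_frame.frame_logic_in_Lambda_MGrz[OF mgrz_frame_A])
  moreover have "frame_logic R_A E_A \<notin> sigma ` Lambda_MIPC"
    using frame_logic_A_not_sigma by (metis imageE)
  ultimately have "sigma ` Lambda_MIPC \<noteq> Lambda_MGrz"
    by metis
  then show ?thesis
    using sigma_in_Lambda_MGrz unfolding inclusion_iso_def bij_betw_def by blast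
qed

end
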